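(* For every subset $\tilde C\subset C$ and every generator $g$ that is an optimal implementation with respect to $\tilde C$, there is a test $t$ such that $(t,g)$ is a basic model-specifying characterization and $\tilde C\subset C[t]$.
   Context: Throughout, $\subset$ allows equality. $C\subset\{0,1\}^n$ (control parameter values) and $D\subset\{0,1\}^m$ (data values) are fixed finite sets of binary strings, $n,m\in\mathbb{N}_0$. A significance level $0<\alpha<1$ is fixed. A machine model is fixed; programs are programs for an ordinary general-purpose computer. In particular, every computable behaviour of the kind allowed in the definition of a test below is realized by some test. For instance, for any subset $A\subset C$, any numbers $M_x\in\mathbb{N}_0$ and any functions $f_x:D^{M_x}\to\{0,1\}$ ($x\in A$), there is a test that outputs $\mathbf{e}$ exactly for $x\in C\setminus A$ and, for $x\in A$, requests $M_x$ samples and outputs the value of $f_x$ on them. Test: a (deterministic) program $t$ that takes $x\in C$ as input, runs, and halts with output $0$, $1$ or $\mathbf{e}$. Whether the output is $\mathbf{e}$ depends only on $x$. When the output is not $\mathbf{e}$, the program may, before halting, request data samples from $D$ one after another. The number of samples requested may depend on the sampled values but is finite for every sequence of successive samples. $C[t]:=\{x\in C : \text{the output of } t \text{ on input } x \text{ is not } \mathbf{e}\}$. For $x\in C[t]$ and $\{y_i\}\in D^\infty$, $t_x(\{y_i\})\in\{0,1\}$ is the output of $t$ on input $x$ when the successive samples are $y_1,y_2,\dots$ (only a finite initial part is used). Generator: a program $g$ that takes $x\in C$ as input, has access to a source of independent, evenly distributed random bits (the machine being otherwise deterministic), outputs some $y\in D$ and halts. $g_x$ denotes the i.i.d. random sequence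 $\{Y_i\}$ of outputs of $g$ in repeated independent runs on input $x$, and $p[g_x](y):=\Pr[Y_1=y]$ for $y\in D$. Resources: $L(q)\in\mathbb{N}_0$ is the length of a program $q$; for every $k\in\mathbb{N}_0$ only finitely many tests and finitely many generators $q$ have $L(q)\le k$. $T(q)\in\mathbb{R}^{\ge0}$ is the average execution time of $q$: the maximum, over all $x\in C$ (and, for tests, all distributions of the input data), of the expected runtime. For a test $t$, $N(t)\in\mathbb{R}^{\ge0}$ is the average number of samples requested: the maximum of its expectation over all $x\in C$ and all distributions of the input data. These quantities are finite. Order: for two tests $p_1,p_2$, $p_1\preceq p_2$ means $L(p_1)\le L(p_2)$, $T(p_1)\le T(p_2)$ and $N(p_1)\le N(p_2)$; for two generators it means $L(p_1)\le L(p_2)$ and $T(p_1)\le T(p_2)$. $p_1\prec p_2$ means $p_1\preceq p_2$ and not $p_2\preceq p_1$. An element $p$ is $\prec$-minimal in a set $P$ of tests (or of generators) if $p\in P$ and there is no $p'\in P$ with $p'\prec p$. Power: for a test $t$, $x\in C[t]$ and a random sequence $\{Y_i\}$ in $D^\infty$, $\mathrm{pow}(t_x,\{Y_i\}):=\Pr[t_x(\{Y_i\})=0]$. Optimal generator: for a test $t$ and $\gamma$ with $\alpha<\gamma<1$, a generator $g$ is an optimal generator relative to $t$ and $\gamma$, written $\mathrm{opt}_t^\gamma\, g$, if (1) $\mathrm{pow}(t_x,g_x)\le\alpha$ for all $x\in C[t]$, and (2) for every generator $g'\prec g$ there is an $x\in C[t]$ such that $\mathrm{pow}(t_x,g'_x)>\gamma$.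 Optimal implementation: a generator $g$ is an optimal implementation with respect to $\tilde C\subset C$ if $g$ is $\prec$-minimal in the set of generators $\{g' : p[g'_x]= p[g_x] \text{ for all } x\in\tilde C\}$. Basic model-specifying characterization: a pair $(t,g)$ of a test $t$ and a generator $g$ such that, for some $\gamma$ with $\alpha<\gamma<1$, $t$ is $\prec$-minimal in the set of tests $\{t' : \mathrm{opt}_{t'}^\gamma\, g \text{ and } C[t]\subset C[t']\}$. *)

theory Defs
  imports "HOL-Probability.Probability"
begin

text \<open>
  Binary digits are Booleans (\<open>False\<close> is 0, \<open>True\<close> is 1), binary strings are \<open>bool list\<close>.

  A program run reads successive items of an external supply: data samples for a test, random
  bits for a generator. Its behaviour is described by the response to each finite supply:
  \<open>Await\<close> if it has read the whole supply and requests a further item, \<open>Diverge\<close> if it runs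
  forever without a further request, and \<open>Halt v \<tau>\<close> if it halts with output \<open>v\<close> after run time \<open>\<tau>\<close>,
  having read some or all of the supply.
\<close>

datatype 'v response = Await | Diverge | Halt 'v real

definition admissible_run :: "('i list \<Rightarrow> 'v response) \<Rightarrow> bool" where
  "admissible_run r \<longleftrightarrow>
     (\<forall>xs ys. r xs \<noteq> Await \<longrightarrow> r (xs @ ys) = r xs) \<and>
     (\<forall>xs v \<tau>. r xs = Halt v \<tau> \<longrightarrow> 0 \<le> \<tau>)"

definition items_read :: "('i list \<Rightarrow> 'v response) \<Rightarrow> (nat \<Rightarrow> 'i) \<Rightarrow> nat" where
  "items_read r s = (LEAST k. \<exists>v \<tau>. r (map s [0..<k]) = Halt v \<tau>)"

text \<open>
  On an infinite supply on which the run does not halt, \<^const>\<open>items_read\<close> is unspecified; the two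
  definitions below then take their second case, whatever its value.
\<close>

definition result :: "('i list \<Rightarrow> 'v response) \<Rightarrow> (nat \<Rightarrow> 'i) \<Rightarrow> 'v option" where
  "result r s = (case r (map s [0..<items_read r s]) of Halt v \<tau> \<Rightarrow> Some v | _ \<Rightarrow> None)"

definition runtime :: "('i list \<Rightarrow> 'v response) \<Rightarrow> (nat \<Rightarrow> 'i) \<Rightarrow> ennreal" where
  "runtime r s = (case r (map s [0..<items_read r s]) of Halt v \<tau> \<Rightarrow> ennreal \<tau> | _ \<Rightarrow> \<infinity>)"

text \<open>
  The output of a test is \<open>None\<close> for the symbol \<open>e\<close> and \<open>Some b\<close> for the digit \<open>b\<close>. The field
  \<open>data_laws\<close> is the class of distributions of the sample sequence over which the average run time
  and the average sample number of a test are maximised.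
\<close>

record 'p setting =
  control :: "bool list set"
  data :: "bool list set"
  data_laws :: "(nat \<Rightarrow> bool list) measure set"
  prog_length :: "'p \<Rightarrow> nat"
  run_test :: "'p \<Rightarrow> bool list \<Rightarrow> bool list list \<Rightarrow> bool option response"
  run_gen :: "'p \<Rightarrow> bool list \<Rightarrow> bool list \<Rightarrow> bool list response"

definition all_laws :: "bool list set \<Rightarrow> (nat \<Rightarrow> bool list) measure set" where
  "all_laws D = {P. prob_space P \<and> sets P = sets (\<Pi>\<^sub>M i\<in>(UNIV :: nat set). count_space D)}"

definition iid_laws :: "bool list set \<Rightarrow> (nat \<Rightarrow> bool list) measure set" where
  "iid_laws D = {\<Pi>\<^sub>M i\<in>(UNIV :: nat set). Q | Q. prob_space Q \<and> sets Q = sets (count_space D)}"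

definition gives_error :: "'p setting \<Rightarrow> 'p \<Rightarrow> bool list \<Rightarrow> bool" where
  "gives_error S t x \<longleftrightarrow> (\<exists>\<tau>. run_test S t x [] = Halt None \<tau>)"

definition is_test :: "'p setting \<Rightarrow> 'p \<Rightarrow> bool" where
  "is_test S t \<longleftrightarrow>
     (\<forall>x\<in>control S. gives_error S t x \<or>
        (\<forall>y. range y \<subseteq> data S \<longrightarrow> (\<exists>b. result (run_test S t x) y = Some (Some b))))"

definition test_domain :: "'p setting \<Rightarrow> 'p \<Rightarrow> bool list set" where
  "test_domain S t = {x \<in> control S. \<not> gives_error S t x}"

definition test_time :: "'p setting \<Rightarrow> 'p \<Rightarrow> ennreal" where
  "test_time S t =
     (SUP x\<in>control S. SUP P\<in>data_laws S. \<integral>\<^sup>+ y. runtime (run_test S t x) y \<partial>P)"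

definition test_samples :: "'p setting \<Rightarrow> 'p \<Rightarrow> ennreal" where
  "test_samples S t =
     (SUP x\<in>control S. SUP P\<in>data_laws S. \<integral>\<^sup>+ y. of_nat (items_read (run_test S t x) y) \<partial>P)"

definition test_le :: "'p setting \<Rightarrow> 'p \<Rightarrow> 'p \<Rightarrow> bool" where
  "test_le S t t' \<longleftrightarrow> prog_length S t \<le> prog_length S t' \<and>
     test_time S t \<le> test_time S t' \<and> test_samples S t \<le> test_samples S t'"

definition coin_flips :: "(nat \<Rightarrow> bool) measure" where
  "coin_flips = (\<Pi>\<^sub>M i\<in>UNIV. measure_pmf (bernoulli_pmf (1 / 2)))"

definition gen_time :: "'p setting \<Rightarrow> 'p \<Rightarrow> ennreal" where
  "gen_time S g = (SUP x\<in>control S. \<integral>\<^sup>+ \<omega>. runtime (run_gen S g x) \<omega> \<partial>coin_flips)"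

text \<open>A generator halts almost surely with an output in the data set; its average run time is finite.\<close>

definition is_generator :: "'p setting \<Rightarrow> 'p \<Rightarrow> bool" where
  "is_generator S g \<longleftrightarrow>
     (\<forall>x\<in>control S. AE \<omega> in coin_flips. \<exists>y\<in>data S. result (run_gen S g x) \<omega> = Some y) \<and>
     gen_time S g < \<infinity>"

definition gen_le :: "'p setting \<Rightarrow> 'p \<Rightarrow> 'p \<Rightarrow> bool" where
  "gen_le S g g' \<longleftrightarrow> prog_length S g \<le> prog_length S g' \<and> gen_time S g \<le> gen_time S g'"

definition repeated_flips :: "(nat \<Rightarrow> nat \<Rightarrow> bool) measure" where
  "repeated_flips = (\<Pi>\<^sub>M i\<in>UNIV. coin_flips)"

text \<open>
  The \<open>i\<close>-th run uses its own coin flips \<open>\<omega> i\<close>. The value \<open>the None\<close> occurs only on the null set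
  where that run does not halt.
\<close>

definition gen_seq :: "'p setting \<Rightarrow> 'p \<Rightarrow> bool list \<Rightarrow> nat \<Rightarrow> (nat \<Rightarrow> nat \<Rightarrow> bool) \<Rightarrow> bool list" where
  "gen_seq S g x i \<omega> = the (result (run_gen S g x) (\<omega> i))"

definition gen_prob :: "'p setting \<Rightarrow> 'p \<Rightarrow> bool list \<Rightarrow> bool list \<Rightarrow> real" where
  "gen_prob S g x y = measure repeated_flips {\<omega> \<in> space repeated_flips. gen_seq S g x 0 \<omega> = y}"

text \<open>
  The last condition says that every behaviour of a test is realised: for each \<open>A\<close>, each number
  \<open>K x y\<close> of samples requested and each output \<open>f x y\<close> that are determined by the samples requested.
  Since the control and data sets are finite, \<open>K x\<close> is bounded (compactness) and such a behaviour is
  a finite table, hence computable. Constant \<open>K x = M\<^sub>x\<close> gives the tests with fixed sample sizes.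
\<close>

definition machine_setting :: "'p setting \<Rightarrow> nat \<Rightarrow> nat \<Rightarrow> bool" where
  "machine_setting S n m \<longleftrightarrow>
     control S \<subseteq> {x. length x = n} \<and>
     data S \<subseteq> {y. length y = m} \<and>
     (data_laws S = all_laws (data S) \<or> data_laws S = iid_laws (data S)) \<and>
     (\<forall>q x. admissible_run (run_test S q x) \<and> admissible_run (run_gen S q x)) \<and>
     (\<forall>k. finite {t. is_test S t \<and> prog_length S t \<le> k}) \<and>
     (\<forall>k. finite {g. is_generator S g \<and> prog_length S g \<le> k}) \<and>
     (\<forall>A K f. A \<subseteq> control S \<longrightarrow>
        (\<forall>x\<in>A. \<forall>y y'. range y \<subseteq> data S \<and> range y' \<subseteq> data S \<and> (\<forall>i<K x y. y i = y' i) \<longrightarrow>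
           K x y = K x y' \<and> f x y = f x y') \<longrightarrow>
        (\<exists>t. is_test S t \<and> test_domain S t = A \<and>
           (\<forall>x\<in>A. \<forall>y. range y \<subseteq> data S \<longrightarrow>
              items_read (run_test S t x) y = K x y \<and>
              result (run_test S t x) y = Some (Some (f x y)))))"

definition pow ::
  "'p setting \<Rightarrow> 'p \<Rightarrow> bool list \<Rightarrow> 'w measure \<Rightarrow> (nat \<Rightarrow> 'w \<Rightarrow> bool list) \<Rightarrow> real" where
  "pow S t x P Y =
     measure P {w \<in> space P. result (run_test S t x) (\<lambda>i. Y i w) = Some (Some False)}"

definition pow_gen :: "'p setting \<Rightarrow> 'p \<Rightarrow> bool list \<Rightarrow> 'p \<Rightarrow> real" where
  "pow_gen S t x g = pow S t x repeated_flips (gen_seq S g x)"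

definition strict :: "('p \<Rightarrow> 'p \<Rightarrow> bool) \<Rightarrow> 'p \<Rightarrow> 'p \<Rightarrow> bool" where
  "strict le p p' \<longleftrightarrow> le p p' \<and> \<not> le p' p"

definition minimal_in :: "('p \<Rightarrow> 'p \<Rightarrow> bool) \<Rightarrow> 'p \<Rightarrow> 'p set \<Rightarrow> bool" where
  "minimal_in le p A \<longleftrightarrow> p \<in> A \<and> \<not> (\<exists>p'\<in>A. strict le p' p)"

definition opt_generator :: "'p setting \<Rightarrow> real \<Rightarrow> real \<Rightarrow> 'p \<Rightarrow> 'p \<Rightarrow> bool" where
  "opt_generator S \<alpha> \<gamma> t g \<longleftrightarrow>
     is_generator S g \<and>
     (\<forall>x\<in>test_domain S t. pow_gen S t x g \<le> \<alpha>) \<and>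
     (\<forall>g'. is_generator S g' \<and> strict (gen_le S) g' g \<longrightarrow>
        (\<exists>x\<in>test_domain S t. pow_gen S t x g' > \<gamma>))"

definition optimal_implementation :: "'p setting \<Rightarrow> bool list set \<Rightarrow> 'p \<Rightarrow> bool" where
  "optimal_implementation S C' g \<longleftrightarrow>
     minimal_in (gen_le S) g
       {g'. is_generator S g' \<and> (\<forall>x\<in>C'. \<forall>y\<in>data S. gen_prob S g' x y = gen_prob S g x y)}"

definition basic_characterization :: "'p setting \<Rightarrow> real \<Rightarrow> 'p \<Rightarrow> 'p \<Rightarrow> bool" where
  "basic_characterization S \<alpha> t g \<longleftrightarrow>
     is_test S t \<and> is_generator S g \<and>
     (\<exists>\<gamma>. \<alpha> < \<gamma> \<and> \<gamma> < 1 \<and>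
        minimal_in (test_le S) t
          {t'. is_test S t' \<and> opt_generator S \<alpha> \<gamma> t' g \<and> test_domain S t \<subseteq> test_domain S t'})"

end

theory Submission
  imports Defs
begin

text \<open>
  Only finitely many generators are strictly cheaper than \<open>g\<close>, and by optimality each of them has
  an output distribution different from that of \<open>g\<close> at some control value in \<open>C'\<close>. So for a
  large enough fixed sample size \<open>k\<close>, a test that compares the observed output frequencies with the
  probabilities of \<open>g\<close> accepts \<open>g\<close> and rejects each cheaper generator somewhere on \<open>C'\<close>, with error
  probabilities controlled by Hoeffding's inequality. Such a test makes \<open>g\<close> optimal relative to
  any \<open>\<gamma>\<close> between \<open>\<alpha>\<close> and 1. Among all tests that do so with a domain containing
  \<open>C'\<close> there is a minimal one, because program length bounds their number; it stays minimal when
  the domain is required to contain, instead of \<open>C'\<close>, that test's own larger domain.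
\<close>

section \<open>Measurability of program outputs\<close>

text \<open>Halting and output are read off finite prefixes, and these range over a countable type,
  so every function of a prefix is measurable. The number of items read is then a measurable
  \<open>LEAST\<close>, and a split over its countably many values gives the output.\<close>

lemma measurable_result:
  fixes r :: "'i :: countable list \<Rightarrow> 'v response"
  shows "result r \<in> measurable (\<Pi>\<^sub>M i\<in>UNIV. count_space UNIV) (count_space UNIV)"
proof -
  let ?M = "\<Pi>\<^sub>M i\<in>(UNIV :: nat set). count_space (UNIV :: 'i set)"
  have prefix: "(\<lambda>s. map s [0..<k]) \<in> measurable ?M (count_space UNIV)" for k
  proof -
    have "(\<lambda>s. map s [0..<k]) -` {l} \<inter> space ?M \<in> sets ?M" for l :: "'i list"
    proof -
      have "map s [0..<k] = l \<longleftrightarrow> length l = k \<and> (\<forall>i\<in>{..<k}. s i = l ! i)" for s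
        by (auto intro: nth_equalityI)
      then have "(\<lambda>s. map s [0..<k]) -` {l} \<inter> space ?M =
          {s \<in> space ?M. length l = k \<and> (\<forall>i\<in>{..<k}. s i = l ! i)}"
        by blast
      also have "\<dots> \<in> sets ?M" by measurable
      finally show ?thesis .
    qed
    then show ?thesis
      by (simp add: measurable_count_space_eq_countable)
  qed
  have count: "f \<in> measurable (count_space UNIV) (count_space UNIV)" for f :: "'i list \<Rightarrow> 'x"
    by simp
  have halts: "Measurable.pred ?M (\<lambda>s. \<exists>v \<tau>. r (map s [0..<k]) = Halt v \<tau>)" for k
    by (rule measurable_compose[OF prefix count])
  have "items_read r \<in> measurable ?M (count_space UNIV)"
    unfolding items_read_def by (rule measurable_Least[OF halts])
  moreover have "(\<lambda>s. case r (map s [0..<k]) of Halt v \<tau> \<Rightarrow> Some v | _ \<Rightarrow> None)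
      \<in> measurable ?M (count_space UNIV)" for k
    by (rule measurable_compose[OF prefix count])
  ultimately show ?thesis
    unfolding result_def by (rule measurable_compose_countable[rotated])
qed

section \<open>Concentration of empirical frequencies\<close>

text \<open>Hoeffding's inequality for the indicators of \<open>P\<close> along the coordinates of
  an infinite product, which are i.i.d. with values in [0, 1].\<close>

lemma frequency_deviation:
  fixes N :: "'a measure" and P :: "'a \<Rightarrow> bool" and k :: nat and \<epsilon> :: real
  assumes N: "prob_space N" and P[measurable]: "Measurable.pred N P" and "0 < k" "0 \<le> \<epsilon>"
  defines "M \<equiv> \<Pi>\<^sub>M i\<in>(UNIV :: nat set). N"
  shows "measure M {\<omega> \<in> space M. \<bar>real (card {i. i < k \<and> P (\<omega> i)}) / real k
           - measure N {w \<in> space N. P w}\<bar> \<ge> \<epsilon>} \<le> 2 * exp (- 2 * real k * \<epsilon>\<^sup>2)"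
proof -
  interpret N: prob_space N by fact
  interpret M: prob_space M unfolding M_def by (intro prob_space_PiM N)
  define Y where "Y w = (indicator {w. P w} w :: real)" for w
  have Y[measurable]: "Y \<in> borel_measurable N" unfolding Y_def by measurable
  have coord: "(\<lambda>\<omega>. \<omega> i) \<in> measurable M N" for i
    unfolding M_def by measurable
  have distr_coord: "distr M N (\<lambda>\<omega>. \<omega> i) = N" for i
    unfolding M_def by (rule distr_PiM_component) (use N in auto)
  \<comment> \<open>Independence means that the joint law is the product of the marginals; here the
    joint map is the identity and both sides are \<open>M\<close>.\<close>
  have "M.indep_vars (\<lambda>_. N) (\<lambda>i \<omega>. \<omega> i) UNIV"
  proof (subst M.indep_vars_iff_distr_eq_PiM')
    show "distr M (Pi\<^sub>M UNIV (\<lambda>_. N)) (\<lambda>x. \<lambda>i\<in>UNIV. x i)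
        = Pi\<^sub>M UNIV (\<lambda>i. distr M N (\<lambda>\<omega>. \<omega> i))"
      by (simp add: distr_coord distr_id[unfolded id_def] restrict_UNIV flip: M_def)
  qed (use coord in auto)
  then have "M.indep_vars (\<lambda>_. borel) (\<lambda>i \<omega>. Y (\<omega> i)) UNIV"
    by (rule M.indep_vars_compose2) auto
  then have indep: "M.indep_vars (\<lambda>_. borel) (\<lambda>i \<omega>. Y (\<omega> i)) {..<k}"
    by (rule M.indep_vars_subset) auto
  have distr_Y: "distr M borel (\<lambda>\<omega>. Y (\<omega> i)) = distr N borel Y" for i
    using distr_distr[OF Y coord[of i]] distr_coord[of i] by (simp add: o_def)
  interpret iid_interval_bounded_random_variables M "{..<k}" "\<lambda>i \<omega>. Y (\<omega> i)" "\<lambda>\<omega>. Y (\<omega> 0)" 0 1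
  proof unfold_locales
    show "(\<lambda>\<omega>. Y (\<omega> 0)) \<in> borel_measurable M"
      using coord Y by (rule measurable_compose)
  qed (use indep distr_Y in \<open>auto simp: Y_def\<close>)
  have "M.expectation (\<lambda>\<omega>. Y (\<omega> 0)) = integral\<^sup>L (distr M N (\<lambda>\<omega>. \<omega> 0)) Y"
    by (rule integral_distr[symmetric]) (use coord in auto)
  also have "\<dots> = integral\<^sup>L N (indicator {w \<in> space N. P w})"
    unfolding distr_coord
    by (rule Bochner_Integration.integral_cong) (auto simp: Y_def indicator_def)
  also have "\<dots> = measure N {w \<in> space N. P w}" by simp
  finally have mean: "M.expectation (\<lambda>\<omega>. Y (\<omega> 0)) = measure N {w \<in> space N. P w}" .
  interpret Hoeffding_ineq_iid M "{..<k}" "\<lambda>i \<omega>. Y (\<omega> i)" "\<lambda>\<omega>. Y (\<omega> 0)" 0 1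
      "measure N {w \<in> space N. P w}"
    by unfold_locales (simp add: mean)
  have "(\<Sum>i<k. Y (\<omega> i)) = real (card {i. i < k \<and> P (\<omega> i)})" for \<omega>
  proof -
    have "(\<Sum>i<k. Y (\<omega> i)) = (\<Sum>i\<in>{i. i < k \<and> P (\<omega> i)}. 1)"
      by (rule sum.mono_neutral_cong_right) (auto simp: Y_def)
    then show ?thesis by simp
  qed
  then show ?thesis
    using Hoeffding_ineq_abs_ge'[of \<epsilon>] \<open>0 < k\<close> \<open>0 \<le> \<epsilon>\<close> by auto
qed

section \<open>Output sequences of generators\<close>

lemma prob_space_coin_flips: "prob_space coin_flips"
  unfolding coin_flips_def by (intro prob_space_PiM measure_pmf.prob_space_axioms)

lemma prob_space_repeated_flips: "prob_space repeated_flips"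
  unfolding repeated_flips_def by (intro prob_space_PiM prob_space_coin_flips)

lemma measurable_gen_output:
  "(\<lambda>w. the (result (run_gen S g x) w)) \<in> measurable coin_flips (count_space UNIV)"
proof -
  have "sets coin_flips = sets (\<Pi>\<^sub>M i\<in>(UNIV :: nat set). count_space (UNIV :: bool set))"
    unfolding coin_flips_def by (intro sets_PiM_cong) auto
  then have "result (run_gen S g x) \<in> measurable coin_flips (count_space UNIV)"
    using measurable_result[of "run_gen S g x"] measurable_cong_sets by blast
  then show ?thesis by (rule measurable_compose) simp
qed

lemma measurable_gen_seq:
  "gen_seq S g x i \<in> measurable repeated_flips (count_space UNIV)"
  unfolding gen_seq_def repeated_flips_def
  by (rule measurable_compose[OF _ measurable_gen_output]) measurable

text \<open>The coordinate of run 0 has law \<open>coin_flips\<close>, so the probability can be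
  computed on a single run, the form in which \<open>frequency_deviation\<close> uses it.\<close>

lemma gen_prob_eq:
  "gen_prob S g x y =
    measure coin_flips {w \<in> space coin_flips. the (result (run_gen S g x) w) = y}"
proof -
  let ?A = "{w \<in> space coin_flips. the (result (run_gen S g x) w) = y}"
  have A: "?A \<in> sets coin_flips"
    using measurable_gen_output[of S g x] by measurable
  have c: "(\<lambda>\<omega>. \<omega> 0) \<in> measurable repeated_flips coin_flips"
    unfolding repeated_flips_def by measurable
  have "measure coin_flips ?A = measure (distr repeated_flips coin_flips (\<lambda>\<omega>. \<omega> 0)) ?A"
    unfolding repeated_flips_def
    by (subst distr_PiM_component) (auto intro: prob_space_coin_flips)
  also have "\<dots> = gen_prob S g x y"
    unfolding gen_prob_def gen_seq_def
    using measurable_space[OF c] by (subst measure_distr[OF c A]) (auto intro!: arg_cong2[where f=measure])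
  finally show ?thesis ..
qed

text \<open>The rejection criterion for a single data value \<open>d\<close> with hypothetical
  probability \<open>p\<close>. The inequality is non-strict so that a tolerance of exactly half the
  distance between two probabilities still separates them.\<close>

definition deviates :: "bool list \<Rightarrow> real \<Rightarrow> real \<Rightarrow> nat \<Rightarrow> (nat \<Rightarrow> bool list) \<Rightarrow> bool" where
  "deviates d p \<epsilon> k y \<longleftrightarrow> \<bar>real (card {i. i < k \<and> y i = d}) / real k - p\<bar> \<ge> \<epsilon>"

text \<open>By the triangle inequality, one frequency cannot be closer than
  \<open>\<epsilon>\<close> to both \<open>p\<close> and \<open>q\<close>. Hence a sample that looks
  typical for \<open>g\<close> at \<open>d\<close> is atypical for a generator with a sufficiently
  different probability there.\<close>

lemma deviates_or_deviates:
  assumes "2 * \<epsilon> \<le> \<bar>p - q\<bar>"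
  shows "deviates d p \<epsilon> k y \<or> deviates d q \<epsilon> k y"
  using assms unfolding deviates_def by linarith

lemma gen_seq_deviates:
  assumes "0 < k" "0 \<le> \<epsilon>"
  shows "measure repeated_flips {\<omega> \<in> space repeated_flips.
    deviates d (gen_prob S g x d) \<epsilon> k (\<lambda>i. gen_seq S g x i \<omega>)} \<le> 2 * exp (- 2 * real k * \<epsilon>\<^sup>2)"
  unfolding gen_prob_eq deviates_def gen_seq_def repeated_flips_def
  by (rule frequency_deviation[OF prob_space_coin_flips _ assms])
    (use measurable_gen_output[of S g x] in measurable)

text \<open>The behaviour of a test is prescribed only on sequences in the data set. A generator may
  leave it on a null set in each run, and countably many null sets remain null.\<close>

lemma AE_gen_seq_in_data:
  assumes "is_generator S g" "x \<in> control S"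
  shows "AE \<omega> in repeated_flips. range (\<lambda>i. gen_seq S g x i \<omega>) \<subseteq> data S"
proof -
  have "AE w in coin_flips. the (result (run_gen S g x) w) \<in> data S"
    using assms unfolding is_generator_def by (auto elim!: eventually_mono)
  then have "AE \<omega> in repeated_flips. gen_seq S g x i \<omega> \<in> data S" for i
    unfolding gen_seq_def repeated_flips_def
    by (intro AE_PiM_component[where P = "\<lambda>w. the (result (run_gen S g x) w) \<in> data S"])
      (auto intro: prob_space_coin_flips)
  then have "AE \<omega> in repeated_flips. \<forall>i. gen_seq S g x i \<omega> \<in> data S"
    by (simp add: AE_all_countable)
  then show ?thesis by (auto elim!: eventually_mono)
qed

lemma measurable_deviates_gen_seq:
  "Measurable.pred repeated_flips (\<lambda>\<omega>. deviates d p \<epsilon> k (\<lambda>i. gen_seq S g x i \<omega>))"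
proof -
  note [measurable] = measurable_gen_seq
  \<comment> \<open>Written as a finite sum of indicators, the count is visibly measurable.\<close>
  have "real (card {i. i < k \<and> gen_seq S g x i \<omega> = d})
      = (\<Sum>i<k. if gen_seq S g x i \<omega> = d then 1 else 0)" for \<omega>
    by (simp add: sum.If_cases) (auto intro!: arg_cong[where f = card])
  then show ?thesis unfolding deviates_def by simp
qed

section \<open>Minimal elements and choice of constants\<close>

text \<open>A minimal element of the finite part of \<open>A\<close> with length at most
  \<open>len a\<close> is minimal in all of \<open>A\<close>: anything strictly below it is no
  longer, hence lies in that part too.\<close>

lemma ex_minimal_in_bounded:
  fixes len :: "'p \<Rightarrow> nat"
  assumes "a \<in> A" and fin: "finite {p \<in> A. len p \<le> len a}"
    and len: "\<And>p q. le p q \<Longrightarrow> len p \<le> len q"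
    and trans: "\<And>p q r. le p q \<Longrightarrow> le q r \<Longrightarrow> le p r"
  shows "\<exists>p. minimal_in le p A"
proof -
  let ?B = "{p \<in> A. len p \<le> len a}"
  have "asymp_on ?B (strict le)"
    by (rule asymp_onI) (simp add: strict_def)
  moreover have "transp_on ?B (strict le)"
    by (rule transp_onI) (metis strict_def trans)
  moreover have "?B \<noteq> {}" using \<open>a \<in> A\<close> by blast
  ultimately have "\<exists>p\<in>?B. \<forall>q\<in>?B. q \<noteq> p \<longrightarrow> \<not> strict le q p"
    by (rule Finite_Set.bex_min_element[OF fin])
  then obtain p where p: "p \<in> ?B" "\<forall>q\<in>?B. q \<noteq> p \<longrightarrow> \<not> strict le q p"
    by (rule bexE)
  have "\<not> strict le q p" if "q \<in> A" for q
  proof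
    assume *: "strict le q p"
    then have "len q \<le> len p" "q \<noteq> p"
      using len[of q p] by (auto simp: strict_def)
    with p(1) that have "q \<in> ?B" by simp
    with p(2) * \<open>q \<noteq> p\<close> show False by blast
  qed
  then have "minimal_in le p A"
    using p(1) unfolding minimal_in_def by blast
  then show ?thesis ..
qed

lemma ex_sample_size:
  fixes c \<eta> \<epsilon> :: real
  assumes "0 < \<epsilon>" "0 < \<eta>"
  shows "\<exists>k>0. c * exp (- 2 * real k * \<epsilon>\<^sup>2) < \<eta>"
proof -
  \<comment> \<open>The bound is a geometric sequence in \<open>k\<close> with ratio below
    1.\<close>
  have "(\<lambda>k. exp (- 2 * \<epsilon>\<^sup>2) ^ k) \<longlonglongrightarrow> 0"
    using assms by (intro LIMSEQ_power_zero) simp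
  then have "(\<lambda>k. c * exp (- 2 * \<epsilon>\<^sup>2) ^ k) \<longlonglongrightarrow> 0"
    by (rule tendsto_mult_right_zero)
  then have "\<forall>\<^sub>F k in sequentially. c * exp (- 2 * \<epsilon>\<^sup>2) ^ k < \<eta>"
    using assms by (intro order_tendstoD)
  then have "\<forall>\<^sub>F k in sequentially. 0 < k \<and> c * exp (- 2 * \<epsilon>\<^sup>2) ^ k < \<eta>"
    using eventually_gt_at_top[of 0] by eventually_elim simp
  then obtain k where "0 < k" "c * exp (- 2 * \<epsilon>\<^sup>2) ^ k < \<eta>"
    by (auto dest!: eventually_happens)
  then show ?thesis
    by (intro exI[of _ k]) (simp add: mult_ac flip: exp_of_nat_mult)
qed

lemma ex_uniform_separation:
  fixes v :: "'a \<Rightarrow> real"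
  assumes "finite I" and "\<And>i. i \<in> I \<Longrightarrow> 0 < v i"
  shows "\<exists>\<delta>>0. \<forall>i\<in>I. \<delta> \<le> v i"
  \<comment> \<open>The inserted 1 keeps the minimum meaningful for empty \<open>I\<close>, which
    occurs when no generator is strictly cheaper than \<open>g\<close>.\<close>
  using assms by (intro exI[of _ "Min (insert 1 (v ` I))"]) auto

section \<open>Power of tests and construction of a separating test\<close>

text \<open>The output 0 is \<open>False\<close>, so power is the probability that \<open>f\<close>
  fails. The two events agree only almost surely, since \<open>f\<close> describes the test only on
  sequences in the data set.\<close>

lemma pow_gen_eq:
  assumes h: "is_generator S h" and x: "x \<in> control S"
    and t: "\<And>y. range y \<subseteq> data S \<Longrightarrow> result (run_test S t x) y = Some (Some (f y))"
    and f: "Measurable.pred repeated_flips (\<lambda>\<omega>. f (\<lambda>i. gen_seq S h x i \<omega>))"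
  shows "pow_gen S t x h =
    measure repeated_flips {\<omega> \<in> space repeated_flips. \<not> f (\<lambda>i. gen_seq S h x i \<omega>)}"
  unfolding pow_gen_def pow_def
proof (rule measure_eq_AE)
  show "AE \<omega> in repeated_flips.
      \<omega> \<in> {w \<in> space repeated_flips. result (run_test S t x) (\<lambda>i. gen_seq S h x i w) = Some (Some False)} \<longleftrightarrow>
      \<omega> \<in> {\<omega> \<in> space repeated_flips. \<not> f (\<lambda>i. gen_seq S h x i \<omega>)}"
    using AE_gen_seq_in_data[OF h x] by eventually_elim (simp add: t)
  have "(\<lambda>\<omega> i. gen_seq S h x i \<omega>) \<in>
      measurable repeated_flips (\<Pi>\<^sub>M i\<in>UNIV. count_space UNIV)"
    by (rule measurable_PiM_single') (use measurable_gen_seq in auto)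
  then have "(\<lambda>\<omega>. result (run_test S t x) (\<lambda>i. gen_seq S h x i \<omega>)) \<in>
      measurable repeated_flips (count_space UNIV)"
    using measurable_result by (rule measurable_compose)
  then show "{w \<in> space repeated_flips. result (run_test S t x) (\<lambda>i. gen_seq S h x i w) = Some (Some False)}
      \<in> sets repeated_flips"
    by measurable
  show "{\<omega> \<in> space repeated_flips. \<not> f (\<lambda>i. gen_seq S h x i \<omega>)} \<in> sets repeated_flips"
    using f by measurable
qed

lemma machine_setting_finite:
  assumes "machine_setting S n m"
  shows "finite (control S)" "finite (data S)"
    "finite {t. is_test S t \<and> prog_length S t \<le> l}"
    "finite {h. is_generator S h \<and> prog_length S h \<le> l}"
proof -
  have "finite {x :: bool list. length x = i}" for i
    using finite_lists_length_eq[of "UNIV :: bool set" i] by simp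
  moreover have "control S \<subseteq> {x. length x = n}"
    using assms unfolding machine_setting_def by (elim conjE)
  moreover have "data S \<subseteq> {y. length y = m}"
    using assms unfolding machine_setting_def by (elim conjE)
  ultimately show "finite (control S)" "finite (data S)"
    by (metis finite_subset)+
  have "\<forall>l. finite {t. is_test S t \<and> prog_length S t \<le> l}"
    using assms unfolding machine_setting_def by (elim conjE)
  then show "finite {t. is_test S t \<and> prog_length S t \<le> l}"
    by (rule spec)
  have "\<forall>l. finite {h. is_generator S h \<and> prog_length S h \<le> l}"
    using assms unfolding machine_setting_def by (elim conjE)
  then show "finite {h. is_generator S h \<and> prog_length S h \<le> l}"
    by (rule spec)
qed

lemma ex_fixed_size_test:
  assumes setting: "machine_setting S n m" and "A \<subseteq> control S"
    and "\<And>x y y'. \<forall>i<k. y i = y' i \<Longrightarrow> f x y = f x y'"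
  shows "\<exists>t. is_test S t \<and> test_domain S t = A \<and>
    (\<forall>x\<in>A. \<forall>y. range y \<subseteq> data S \<longrightarrow> items_read (run_test S t x) y = k \<and>
      result (run_test S t x) y = Some (Some (f x y)))"
proof -
  have "\<forall>A K f. A \<subseteq> control S \<longrightarrow>
      (\<forall>x\<in>A. \<forall>y y'. range y \<subseteq> data S \<and> range y' \<subseteq> data S \<and> (\<forall>i<K x y. y i = y' i) \<longrightarrow>
         K x y = K x y' \<and> f x y = f x y') \<longrightarrow>
      (\<exists>t. is_test S t \<and> test_domain S t = A \<and>
         (\<forall>x\<in>A. \<forall>y. range y \<subseteq> data S \<longrightarrow> items_read (run_test S t x) y = K x y \<and>
            result (run_test S t x) y = Some (Some (f x y))))"
    using setting unfolding machine_setting_def by (elim conjE)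
  note this[THEN spec[of _ A], THEN spec[of _ "\<lambda>_ _. k"], THEN spec[of _ f], THEN mp, THEN mp]
  then show ?thesis
    using assms(2,3) by simp
qed

text \<open>The test accepts at \<open>x\<close> if no data value has a deviating frequency relative
  to \<open>g\<close>. A union bound over the data values limits the rejection of \<open>g\<close>;
  a single well-separated value suffices to reject a cheaper generator.\<close>

lemma ex_opt_test:
  assumes setting: "machine_setting S n m" and "0 < \<alpha>" "\<gamma> < 1" and C': "C' \<subseteq> control S"
    and opt: "optimal_implementation S C' g"
  shows "\<exists>t. is_test S t \<and> test_domain S t = C' \<and> opt_generator S \<alpha> \<gamma> t g"
proof -
  have fin: "finite C'" "finite (data S)"
    using C' machine_setting_finite[OF setting] by (auto intro: finite_subset)
  have gen_g: "is_generator S g"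
    using opt unfolding optimal_implementation_def minimal_in_def by simp
  define G where "G = {h. is_generator S h \<and> strict (gen_le S) h g}"
  have "finite {h. is_generator S h \<and> prog_length S h \<le> prog_length S g}"
    by (rule machine_setting_finite[OF setting])
  then have "finite G"
    by (rule rev_finite_subset) (auto simp: G_def strict_def gen_le_def)
  define dist where
    "dist = (\<lambda>(h, x, d). \<bar>gen_prob S h x d - gen_prob S g x d\<bar>)"
  \<comment> \<open>Keeping only the triples with positive distance gives finitely many positive
    numbers, hence a common lower bound \<delta>.\<close>
  define I where "I = {i \<in> G \<times> C' \<times> data S. 0 < dist i}"
  have "finite I"
    using \<open>finite G\<close> fin unfolding I_def by simp
  then obtain \<delta> where "0 < \<delta>" and \<delta>: "\<And>i. i \<in> I \<Longrightarrow> \<delta> \<le> dist i"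
    using ex_uniform_separation[of I dist] unfolding I_def by blast
  have sep: "\<exists>x\<in>C'. \<exists>d\<in>data S. \<delta> \<le> \<bar>gen_prob S h x d - gen_prob S g x d\<bar>" if h: "h \<in> G" for h
  proof -
    \<comment> \<open>If \<open>h\<close> agreed with \<open>g\<close> everywhere on
      \<open>C'\<close>, it would compete with \<open>g\<close> in the minimality condition and
      contradict it.\<close>
    obtain x d where "x \<in> C'" "d \<in> data S" "gen_prob S h x d \<noteq> gen_prob S g x d"
      using h opt unfolding G_def optimal_implementation_def minimal_in_def by blast
    then show ?thesis
      using \<delta>[of "(h, x, d)"] h unfolding I_def dist_def by force
  qed
  define \<epsilon> where "\<epsilon> = \<delta> / 2"
  have "0 < \<epsilon>" using \<open>0 < \<delta>\<close> unfolding \<epsilon>_def by simp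
  \<comment> \<open>One sample size serves both errors: the \<open>card (data S)\<close> terms of
    the union bound for \<open>g\<close>, which must stay below \<alpha>, and the one term for
    accepting a cheaper generator, which must stay below 1 - \<gamma>.\<close>
  obtain k where "0 < k" and
    k: "2 * (real (card (data S)) + 1) * exp (- 2 * real k * \<epsilon>\<^sup>2) < min \<alpha> (1 - \<gamma>)"
    using ex_sample_size[of \<epsilon> "min \<alpha> (1 - \<gamma>)"] \<open>0 < \<epsilon>\<close> \<open>0 < \<alpha>\<close> \<open>\<gamma> < 1\<close> by auto
  define e where "e = exp (- 2 * real k * \<epsilon>\<^sup>2)"
  have e: "0 < e" "card (data S) * (2 * e) + 2 * e < \<alpha>" "card (data S) * (2 * e) + 2 * e < 1 - \<gamma>"
    using k by (simp_all add: e_def algebra_simps)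
  define f where "f x y \<longleftrightarrow> (\<forall>d\<in>data S. \<not> deviates d (gen_prob S g x d) \<epsilon> k y)" for x y
  have f_local: "f x y = f x y'" if "\<forall>i<k. y i = y' i" for x y y'
  proof -
    have "{i. i < k \<and> y i = d} = {i. i < k \<and> y' i = d}" for d
      using that by auto
    then show ?thesis unfolding f_def deviates_def by simp
  qed
  have "\<exists>t. is_test S t \<and> test_domain S t = C' \<and>
      (\<forall>x\<in>C'. \<forall>y. range y \<subseteq> data S \<longrightarrow> items_read (run_test S t x) y = k \<and>
        result (run_test S t x) y = Some (Some (f x y)))"
    using f_local by (intro ex_fixed_size_test[OF setting C']) blast
  then obtain t where t: "is_test S t" "test_domain S t = C'"
    "\<And>x y. x \<in> C' \<Longrightarrow> range y \<subseteq> data S \<Longrightarrow> result (run_test S t x) y = Some (Some (f x y))"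
    by blast
  interpret R: prob_space repeated_flips by (rule prob_space_repeated_flips)
  note [measurable] = measurable_deviates_gen_seq
  have f_meas[measurable]: "Measurable.pred repeated_flips (\<lambda>\<omega>. f x (\<lambda>i. gen_seq S h x i \<omega>))" for x h
    unfolding f_def using fin(2) by measurable
  let ?dev = "\<lambda>h x p d. {\<omega> \<in> space repeated_flips. deviates d p \<epsilon> k (\<lambda>i. gen_seq S h x i \<omega>)}"
  have dev: "R.prob (?dev h x (gen_prob S h x d) d) \<le> 2 * e" for h x d
    unfolding e_def using \<open>0 < k\<close> \<open>0 < \<epsilon>\<close> by (intro gen_seq_deviates) auto
  have pow: "pow_gen S t x h =
      R.prob {\<omega> \<in> space repeated_flips. \<not> f x (\<lambda>i. gen_seq S h x i \<omega>)}"
    if "is_generator S h" "x \<in> C'" for h x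
    using that C' t(3)[OF that(2)] f_meas by (intro pow_gen_eq) auto
  have "pow_gen S t x g \<le> \<alpha>" if "x \<in> C'" for x
  proof -
    have "pow_gen S t x g = R.prob (\<Union>d\<in>data S. ?dev g x (gen_prob S g x d) d)"
      unfolding pow[OF gen_g that] f_def by (rule arg_cong[where f = R.prob]) auto
    also have "\<dots> \<le> (\<Sum>d\<in>data S. R.prob (?dev g x (gen_prob S g x d) d))"
      using fin(2) by (intro R.finite_measure_subadditive_finite) auto
    also have "\<dots> \<le> (\<Sum>d\<in>data S. 2 * e)"
      by (intro sum_mono dev)
    also have "\<dots> \<le> \<alpha>" using e by simp
    finally show ?thesis .
  qed
  moreover have "\<exists>x\<in>C'. \<gamma> < pow_gen S t x h" if h: "h \<in> G" for h
  proof -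
    obtain x d where xd: "x \<in> C'" "d \<in> data S" "\<delta> \<le> \<bar>gen_prob S h x d - gen_prob S g x d\<bar>"
      using sep[OF h] by blast
    have gen_h: "is_generator S h" using h unfolding G_def by simp
    have either: "deviates d (gen_prob S h x d) \<epsilon> k y \<or> deviates d (gen_prob S g x d) \<epsilon> k y" for y
      using xd(3) by (intro deviates_or_deviates) (simp add: \<epsilon>_def)
    have "1 - pow_gen S t x h
        = R.prob {\<omega> \<in> space repeated_flips. f x (\<lambda>i. gen_seq S h x i \<omega>)}"
      unfolding pow[OF gen_h xd(1)] by (subst R.prob_neg) auto
    \<comment> \<open>Acceptance means that the frequency of \<open>d\<close> is close to its
      probability under \<open>g\<close>; it must then deviate from its probability under
      \<open>h\<close>, which is unlikely when \<open>h\<close> produces the samples.\<close>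
    also have "\<dots> \<le> R.prob (?dev h x (gen_prob S h x d) d)"
    proof (rule R.finite_measure_mono)
      show "{\<omega> \<in> space repeated_flips. f x (\<lambda>i. gen_seq S h x i \<omega>)}
          \<subseteq> ?dev h x (gen_prob S h x d) d"
        using xd(2) either unfolding f_def by blast
    qed measurable
    also have "\<dots> \<le> 2 * e" by (rule dev)
    also have "\<dots> < 1 - \<gamma>" using e by (smt (verit) mult_nonneg_nonneg of_nat_0_le_iff)
    finally show ?thesis using xd(1) by auto
  qed
  ultimately have "opt_generator S \<alpha> \<gamma> t g"
    using gen_g unfolding opt_generator_def t(2) G_def by blast
  with t show ?thesis by blast
qed

theorem theorem6:
  fixes S :: "'p setting" and n m :: nat and \<alpha> :: real
    and C' :: "bool list set" and g :: 'p
  assumes "machine_setting S n m"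
    and "0 < \<alpha>" and "\<alpha> < 1"
    and "C' \<subseteq> control S"
    and "optimal_implementation S C' g"
  shows "\<exists>t. basic_characterization S \<alpha> t g \<and> C' \<subseteq> test_domain S t"
proof -
  obtain \<gamma> where \<gamma>: "\<alpha> < \<gamma>" "\<gamma> < 1"
    using dense[OF \<open>\<alpha> < 1\<close>] by blast
  \<comment> \<open>The required domain is a parameter because it changes from \<open>C'\<close> to
    the domain of the minimal test, which may be larger.\<close>
  define A where "A B = {t. is_test S t \<and> opt_generator S \<alpha> \<gamma> t g \<and> B \<subseteq> test_domain S t}" for B
  obtain t\<^sub>0 where "t\<^sub>0 \<in> A C'"
    using ex_opt_test[OF assms(1,2) \<gamma>(2) assms(4,5)] unfolding A_def by blast
  moreover have "finite {t. is_test S t \<and> prog_length S t \<le> prog_length S t\<^sub>0}"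
    by (rule machine_setting_finite[OF assms(1)])
  then have "finite {t \<in> A C'. prog_length S t \<le> prog_length S t\<^sub>0}"
    by (rule rev_finite_subset) (auto simp: A_def)
  ultimately obtain t where t: "minimal_in (test_le S) t (A C')"
    using ex_minimal_in_bounded[of t\<^sub>0 "A C'" "prog_length S" "test_le S"]
    unfolding test_le_def by (meson order_trans)
  then have "t \<in> A C'" unfolding minimal_in_def by blast
  \<comment> \<open>A larger required domain leaves fewer competitors, and \<open>t\<close> itself
    is still among them, so its minimality is inherited.\<close>
  then have "t \<in> A (test_domain S t)" "A (test_domain S t) \<subseteq> A C'"
    unfolding A_def by auto
  with t have "minimal_in (test_le S) t (A (test_domain S t))"
    unfolding minimal_in_def by blast
  moreover have "is_generator S g"
    using \<open>t \<in> A C'\<close> unfolding A_def opt_generator_def by blast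
  ultimately show ?thesis
    using \<open>t \<in> A C'\<close> \<gamma> unfolding basic_characterization_def A_def by blast
qed

end
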